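(* Let $\theta\sim U[0,1]$ and $s(d)=d^\alpha$ with $\alpha\in(0,1)$ (endogenous interest rate with constant elasticity). Let $R^I=\frac{\mathbb E(\Pi^{fb})}{\mathbb E(\Pi)}$ be the relative regret. Then $R^I\ge2$ for every $\rho\in(0,1)$, and for any $M>0$ there exists $\rho\in(0,1)$ for which $R^I>M$.
   Context: For $\rho\in(0,1)$, $d^*\in(0,\rho)$ denotes the unique solution of $$\frac{1-s(d^* )d^*}{1-s(d^* )\rho}=\frac{s(d^* )+s'(d^* )d^*}{\rho s'(d^* )}.$$ Endogenous-rate lending problem: in each period $t=0,1,\dots$ in which the relationship is active the lender chooses a repayment amount $y_t\ge0$ and a discount rate $d_t\in(0,\rho)$; the consumer, of fixed income $\theta$ unknown to the lender, accepts with probability $s(d_t)$ (otherwise she exits for good), receives $d_ty_t$, and at the end of the period repays $y_t$ if $\theta\ge y_t$ and otherwise defaults and exits; cash flows are discounted at $\rho$. $\mathbb E(\Pi)$ denotes the lender's optimal expected NPV when $\theta\sim U[0,1]$; it is given by $$\mathbb E(\Pi)=\frac{\big((1-\bar x)d^*\big)^{\alpha+1}}{\alpha}\,\bar x,\qquad \bar x=\frac1{\alpha+2}.$$ The first-best (known $\theta$) benchmark is taken to be $\Pi^{fb}(\theta)=\frac{1-s(d^* )d^*}{1-s(d^* )\rho}\,\theta$, so that $\mathbb E(\Pi^{fb})=\frac{1-s(d^* )d^*}{2(1-s(d^* )\rho)}$. *)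

theory Defs
  imports "HOL-Analysis.Analysis"
begin

abbreviation unif01 :: "real measure" where
  "unif01 \<equiv> uniform_measure lborel {0..1}"

definition dstar :: "(real \<Rightarrow> real) \<Rightarrow> real \<Rightarrow> real" where
  "dstar s \<rho> = (THE d. 0 < d \<and> d < \<rho> \<and>
     (1 - s d * d) / (1 - s d * \<rho>) = (s d + deriv s d * d) / (\<rho> * deriv s d))"

definition first_best :: "(real \<Rightarrow> real) \<Rightarrow> real \<Rightarrow> real \<Rightarrow> real" where
  "first_best s \<rho> \<theta> = (1 - s (dstar s \<rho>) * dstar s \<rho>) / (1 - s (dstar s \<rho>) * \<rho>) * \<theta>"

definition expected_first_best :: "(real \<Rightarrow> real) \<Rightarrow> real \<Rightarrow> real" where
  "expected_first_best s \<rho> = (\<integral>\<theta>. first_best s \<rho> \<theta> \<partial>unif01)"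

text \<open>
  A lending policy is a pair of deterministic sequences: as long as the relationship is active,
  the lender has only observed acceptances and repayments, so the history carries no
  information beyond the period index.
\<close>

definition lending_policy :: "real \<Rightarrow> (nat \<Rightarrow> real) \<Rightarrow> (nat \<Rightarrow> real) \<Rightarrow> bool" where
  "lending_policy \<rho> y d \<longleftrightarrow> (\<forall>t. 0 \<le> y t \<and> 0 < d t \<and> d t < \<rho>)"

text \<open>
  NPV of a policy against a consumer of income \<open>\<theta>\<close>, in expectation over the acceptance decisions.
  The loan of period \<open>t\<close> is made if the consumer has repaid all earlier ones and has accepted all
  offers up to and including the one of period \<open>t\<close>, which has probability \<open>\<Prod>i\<le>t. s (d i)\<close>.
  The loan \<open>d t * y t\<close> is paid out at the start of the period (discount factor \<open>\<rho> ^ t\<close>), the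
  repayment is received at its end (discount factor \<open>\<rho> ^ (t + 1)\<close>).
  For \<open>0 \<le> \<theta> \<le> 1\<close> and a policy with \<open>0 < \<rho> < 1\<close> and \<open>s\<close> with values in \<open>[0, 1]\<close> on \<open>(0, \<rho>)\<close>,
  the series converges absolutely: there is at most one defaulted loan, and the
  repaid ones are at most \<open>1\<close>.
\<close>

definition npv ::
  "(real \<Rightarrow> real) \<Rightarrow> real \<Rightarrow> (nat \<Rightarrow> real) \<Rightarrow> (nat \<Rightarrow> real) \<Rightarrow> real \<Rightarrow> real" where
  "npv s \<rho> y d \<theta> = (\<Sum>t. \<rho> ^ t * (\<Prod>i\<le>t. s (d i)) *
     (if \<forall>i<t. y i \<le> \<theta> then (if y t \<le> \<theta> then \<rho> * y t else 0) - d t * y t else 0))"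

definition optimal_npv :: "(real \<Rightarrow> real) \<Rightarrow> real \<Rightarrow> real" where
  "optimal_npv s \<rho> =
     Sup {(\<integral>\<theta>. npv s \<rho> y d \<theta> \<partial>unif01) | y d. lending_policy \<rho> y d}"

text \<open>
  The closed form for the lender's expected NPV with acceptance probability \<open>s d = d powr \<alpha>\<close>. It is
  the value of the policy that always asks for \<open>x = 1 / (\<alpha> + 2)\<close>, at the rate \<open>(1 - x) * d\<^sup>*\<close> in
  period \<open>0\<close> and at the rate \<open>d\<^sup>*\<close> afterwards. It is kept apart from \<open>optimal_npv\<close>, because for
  \<open>\<rho>\<close> close to \<open>1\<close> asking for a smaller amount first, at a rate close to \<open>\<rho>\<close>, does better.
\<close>

definition closed_form_npv :: "real \<Rightarrow> real \<Rightarrow> real" where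
  "closed_form_npv \<alpha> \<rho> =
     (let x = 1 / (\<alpha> + 2)
      in ((1 - x) * dstar (\<lambda>d. d powr \<alpha>) \<rho>) powr (\<alpha> + 1) / \<alpha> * x)"

definition relative_regret :: "real \<Rightarrow> real \<Rightarrow> real" where
  "relative_regret fb v = fb / v"

end

(*
  Write D for the power alpha + 1 of d* and K = D / alpha. The first-order condition reduces to
  rho * (alpha + D) = (1 + alpha) * d*, so the first-best coefficient equals 1 + K, and Young's
  inequality says that K bounds the NPV per unit of repayment against a consumer who never
  defaults: s d * (rho - d) <= K * (1 - rho * s d) for every rate d.

  For an unknown income, the loan of period t earns at most (rho - d_t) * y_t, and only from
  incomes of at least y_t. Under the uniform prior its expected profit is thus at most
  (rho - d_t) * y_t * (1 - y_t) <= (rho - d_t) / 4, and telescoping over t bounds the value of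
  every policy by K / 4. The closed form satisfies the same bound. Hence both regrets are at least
  ((1 + K) / 2) / (K / 4) = 2 + 2 / K, and K < rho / alpha.
*)

theory Submission
  imports Defs
begin

section \<open>The rate \<open>d\<^sup>*\<close> for constant elasticity\<close>

text \<open>For a power the derivative is \<alpha> * p / d with p = \<open>d powr \<alpha>\<close>,
  so p cancels on the right and leaves (1 + \<alpha>) * d / (\<rho> * \<alpha>). After
  cross-multiplication the terms in \<rho> * p * d merge into one.\<close>

lemma first_order_condition_powr_iff:
  fixes \<alpha> \<rho> d :: real
  assumes "0 < \<alpha>" "0 < d" "d < \<rho>" "\<rho> < 1"
  shows "(1 - d powr \<alpha> * d) / (1 - d powr \<alpha> * \<rho>)
           = (d powr \<alpha> + deriv (\<lambda>d. d powr \<alpha>) d * d) / (\<rho> * deriv (\<lambda>d. d powr \<alpha>) d)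
         \<longleftrightarrow> \<rho> * (\<alpha> + d powr (\<alpha> + 1)) = (1 + \<alpha>) * d"
proof -
  define p where "p = d powr \<alpha>"
  have p: "0 < p" "p < 1"
    using assms powr_less_one[of \<alpha> d] powr_less_mono2[of \<alpha> d 1] by (auto simp: p_def)
  have "((\<lambda>d. d powr \<alpha>) has_real_derivative \<alpha> * d powr (\<alpha> - 1)) (at d)"
    using assms by (intro has_real_derivative_powr) auto
  then have deriv: "deriv (\<lambda>d. d powr \<alpha>) d = \<alpha> * p / d"
    using assms by (simp add: DERIV_imp_deriv p_def powr_diff)
  have "p * \<rho> < 1 * 1"
    using p assms by (intro mult_strict_mono) auto
  then have den: "1 - p * \<rho> \<noteq> 0" by simp
  have "(p + \<alpha> * p / d * d) / (\<rho> * (\<alpha> * p / d)) = (1 + \<alpha>) * d / (\<rho> * \<alpha>)"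
    using p assms by (simp add: field_simps)
  then have "(1 - p * d) / (1 - p * \<rho>) = (p + \<alpha> * p / d * d) / (\<rho> * (\<alpha> * p / d))
      \<longleftrightarrow> (1 - p * d) * (\<rho> * \<alpha>) = (1 + \<alpha>) * d * (1 - p * \<rho>)"
    using den assms by (simp add: frac_eq_eq)
  also have "\<dots> \<longleftrightarrow> \<rho> * (\<alpha> + p * d) = (1 + \<alpha>) * d"
    by (auto simp: algebra_simps)
  finally show ?thesis
    using assms unfolding deriv p_def[symmetric] by (simp add: powr_add p_def)
qed

text \<open>Makes the \<open>THE\<close> in \<open>dstar\<close> meaningful. The difference
  \<open>h\<close> of the two sides changes sign between 0 and \<rho>, and its derivative (1 +
  \<alpha>) * (\<rho> * \<open>x powr \<alpha>\<close> - 1) is negative there, so it has exactly one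
  zero.\<close>

lemma ex1_first_order_condition:
  fixes \<alpha> \<rho> :: real
  assumes "0 < \<alpha>" "0 < \<rho>" "\<rho> < 1"
  shows "\<exists>!d. 0 < d \<and> d < \<rho> \<and> \<rho> * (\<alpha> + d powr (\<alpha> + 1)) = (1 + \<alpha>) * d"
proof -
  define h where "h = (\<lambda>d. \<rho> * (\<alpha> + d powr (\<alpha> + 1)) - (1 + \<alpha>) * d)"
  have "continuous_on {0..\<rho>} h"
    unfolding h_def using assms by (intro continuous_intros continuous_on_powr') auto
  moreover have h0: "0 < h 0"
    using assms by (simp add: h_def)
  moreover have h\<rho>: "h \<rho> < 0"
  proof -
    have "\<rho> powr (\<alpha> + 1) < 1"
      using assms powr_less_mono2[of "\<alpha> + 1" \<rho> 1] by simp
    then have "\<rho> * (\<alpha> + \<rho> powr (\<alpha> + 1)) < \<rho> * (\<alpha> + 1)"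
      using assms by simp
    then show ?thesis by (simp add: h_def algebra_simps)
  qed
  ultimately obtain d where d: "0 \<le> d" "d \<le> \<rho>" "h d = 0"
    using IVT2'[of h \<rho> 0 0] assms by auto
  have "0 < d" "d < \<rho>"
    using d h0 h\<rho> by (metis less_eq_real_def less_irrefl)+
  have decr: "h b < h a" if "0 < a" "a < b" "b < \<rho>" for a b
  proof (rule DERIV_neg_imp_decreasing[OF \<open>a < b\<close>])
    fix x assume x: "a \<le> x" "x \<le> b"
    then have "0 < x" "x < \<rho>" using that by auto
    have "(h has_real_derivative \<rho> * ((\<alpha> + 1) * x powr \<alpha>) - (1 + \<alpha>)) (at x)"
      unfolding h_def using \<open>0 < x\<close> by (auto intro!: derivative_eq_intros)
    moreover have "\<rho> * x powr \<alpha> < 1 * 1"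
      using \<open>0 < x\<close> \<open>x < \<rho>\<close> assms powr_less_mono2[of \<alpha> x 1] by (intro mult_strict_mono) auto
    then have "(1 + \<alpha>) * (\<rho> * x powr \<alpha> - 1) < 0"
      using assms by (simp add: mult_pos_neg)
    ultimately show "\<exists>y. (h has_real_derivative y) (at x) \<and> y < 0"
      by (intro exI conjI) (auto simp: algebra_simps)
  qed
  have "e = d" if e: "0 < e" "e < \<rho>" "h e = 0" for e
    using decr[of e d] decr[of d e] e \<open>0 < d\<close> \<open>d < \<rho>\<close> \<open>h d = 0\<close> by (cases e d rule: linorder_cases) auto
  then have "\<exists>!d. 0 < d \<and> d < \<rho> \<and> h d = 0"
    using \<open>0 < d\<close> \<open>d < \<rho>\<close> \<open>h d = 0\<close> by blast
  then show ?thesis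
    by (simp add: h_def)
qed

lemma dstar_powr:
  fixes \<alpha> \<rho> :: real
  assumes "0 < \<alpha>" "0 < \<rho>" "\<rho> < 1"
  defines "\<delta> \<equiv> dstar (\<lambda>d. d powr \<alpha>) \<rho>"
  shows "0 < \<delta>" "\<delta> < \<rho>" "\<rho> * (\<alpha> + \<delta> powr (\<alpha> + 1)) = (1 + \<alpha>) * \<delta>"
proof -
  have "\<delta> = (THE d. 0 < d \<and> d < \<rho> \<and> \<rho> * (\<alpha> + d powr (\<alpha> + 1)) = (1 + \<alpha>) * d)"
    unfolding \<delta>_def dstar_def
    using first_order_condition_powr_iff assms by (intro arg_cong[of _ _ The] ext) blast
  with theI'[OF ex1_first_order_condition[OF assms(1-3)]]
  show "0 < \<delta>" "\<delta> < \<rho>" "\<rho> * (\<alpha> + \<delta> powr (\<alpha> + 1)) = (1 + \<alpha>) * \<delta>"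
    by auto
qed

lemma first_best_coefficient_powr:
  fixes \<alpha> \<rho> :: real
  assumes "0 < \<alpha>" "0 < \<rho>" "\<rho> < 1"
  defines "\<delta> \<equiv> dstar (\<lambda>d. d powr \<alpha>) \<rho>"
  shows "(1 - \<delta> powr \<alpha> * \<delta>) / (1 - \<delta> powr \<alpha> * \<rho>) = 1 + \<delta> powr (\<alpha> + 1) / \<alpha>"
proof -
  have \<delta>: "0 < \<delta>" "\<delta> < \<rho>" and foc: "\<rho> * (\<alpha> + \<delta> powr (\<alpha> + 1)) = (1 + \<alpha>) * \<delta>"
    using dstar_powr assms by auto
  define p where "p = \<delta> powr \<alpha>"
  have p: "0 < p" "p < 1"
    using \<delta> assms powr_less_mono2[of \<alpha> \<delta> 1] by (auto simp: p_def)
  have p\<delta>: "\<delta> powr (\<alpha> + 1) = p * \<delta>"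
    using \<delta> by (simp add: powr_add p_def)
  have "p * \<rho> < 1 * 1"
    using p assms by (intro mult_strict_mono) auto
  \<comment> \<open>Multiplied by \<open>p\<close>, the first-order condition is the
    cross-multiplied claim up to rearrangement.\<close>
  moreover have "p * (\<rho> * (\<alpha> + p * \<delta>)) = p * ((1 + \<alpha>) * \<delta>)"
    using foc p\<delta> by simp
  then have "(1 - p * \<delta>) * \<alpha> = (\<alpha> + p * \<delta>) * (1 - p * \<rho>)"
    by (simp add: algebra_simps)
  ultimately have "(1 - p * \<delta>) / (1 - p * \<rho>) = (\<alpha> + p * \<delta>) / \<alpha>"
    using assms by (subst frac_eq_eq) auto
  then show ?thesis
    using assms p\<delta> by (simp add: p_def add_divide_distrib)
qed

text \<open>Young's inequality for \<delta> and \<open>d powr \<alpha>\<close> with the conjugate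
  exponents \<alpha> + 1 and (\<alpha> + 1) / \<alpha>. It is tight at d = \<delta>, so no smaller
  \<open>K\<close> would do.\<close>

lemma powr_rate_value_le:
  fixes \<alpha> \<rho> d :: real
  assumes "0 < \<alpha>" "0 < \<rho>" "\<rho> < 1" "0 < d"
  defines "K \<equiv> dstar (\<lambda>d. d powr \<alpha>) \<rho> powr (\<alpha> + 1) / \<alpha>"
  shows "d powr \<alpha> * (\<rho> - d) \<le> K * (1 - \<rho> * d powr \<alpha>)"
proof -
  define \<delta> where "\<delta> = dstar (\<lambda>d. d powr \<alpha>) \<rho>"
  have \<delta>: "0 < \<delta>" and foc: "\<rho> * (\<alpha> + \<delta> powr (\<alpha> + 1)) = (1 + \<alpha>) * \<delta>"
    using dstar_powr assms by (auto simp: \<delta>_def)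
  have K: "K * \<alpha> = \<delta> powr (\<alpha> + 1)"
    using assms by (simp add: K_def \<delta>_def)
  have "\<delta> * d powr \<alpha> \<le> \<delta> powr (\<alpha> + 1) / (\<alpha> + 1)
      + (d powr \<alpha>) powr ((\<alpha> + 1) / \<alpha>) / ((\<alpha> + 1) / \<alpha>)"
    using assms \<delta> by (intro Youngs_inequality) (auto simp: field_simps)
  also have "(d powr \<alpha>) powr ((\<alpha> + 1) / \<alpha>) = d powr \<alpha> * d"
    using assms by (simp add: powr_powr powr_add)
  finally have "(\<alpha> + 1) * (\<delta> * d powr \<alpha>)
      \<le> (\<alpha> + 1) * (K * \<alpha> / (\<alpha> + 1) + d powr \<alpha> * d / ((\<alpha> + 1) / \<alpha>))"
    using assms unfolding K by (intro mult_left_mono) auto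
  also have "\<dots> = K * \<alpha> + \<alpha> * (d powr \<alpha> * d)"
    using assms by (simp add: distrib_left)
  finally have "(\<alpha> + 1) * (\<delta> * d powr \<alpha>) \<le> K * \<alpha> + \<alpha> * (d powr \<alpha> * d)" .
  \<comment> \<open>The first-order condition removes \<delta> from the left side of Young's
    inequality; what remains is the claim times \<alpha>.\<close>
  moreover have "\<rho> * (\<alpha> + K * \<alpha>) * d powr \<alpha> = (1 + \<alpha>) * \<delta> * d powr \<alpha>"
    using foc K by simp
  ultimately have "\<alpha> * (d powr \<alpha> * (\<rho> - d)) \<le> \<alpha> * (K * (1 - \<rho> * d powr \<alpha>))"
    by (simp add: algebra_simps)
  then show ?thesis
    by (rule mult_left_le_imp_le[OF _ assms(1)])
qed

section \<open>Expectations over a uniform income\<close>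

lemma finite_measure_unif01: "finite_measure unif01"
  by (rule finite_measureI) simp

lemma measure_unif01: "B \<in> sets borel \<Longrightarrow> measure unif01 B = measure lborel ({0..1} \<inter> B)"
  by (subst measure_uniform_measure) auto

lemma integrable_indicator_unif01:
  "B \<in> sets borel \<Longrightarrow> integrable unif01 (indicator B :: real \<Rightarrow> real)"
  by (rule finite_measure.integrable_const_bound[OF finite_measure_unif01, where B = 1])
    (auto simp: indicator_def)

lemma AE_unif01: "AE \<theta> in unif01. 0 \<le> \<theta> \<and> \<theta> \<le> 1"
  by (rule AE_uniform_measureI) auto

lemma integral_unif01_id: "(\<integral>\<theta>. \<theta> \<partial>unif01) = 1 / 2"
proof -
  \<comment> \<open>The interval has length 1, so the density is the bare indicator.\<close>
  have "(\<integral>\<theta>. \<theta> \<partial>unif01) = (\<integral>\<theta>. \<theta> \<partial>density lborel (\<lambda>\<theta>. ennreal (indicator {0..1} \<theta>)))"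
    by (simp add: uniform_measure_def ennreal_indicator divide_ennreal_def)
  also have "\<dots> = (\<integral>\<theta>. \<theta> ^ 1 * indicator {0..1} \<theta> \<partial>lborel)"
    by (subst integral_density) (auto simp: mult.commute)
  also have "\<dots> = 1 / 2"
    by (subst integral_power) auto
  finally show ?thesis .
qed

text \<open>Posted-price revenue: a mass 1 - y of incomes can repay y \<le> 1, and y * (1 - y) peaks
  at y = 1/2; nobody repays more than 1. This is the source of the factor 1/4.\<close>

lemma demand_revenue_le:
  fixes y :: real
  assumes "0 \<le> y"
  shows "y * measure unif01 {y..} \<le> 1 / 4"
proof (cases "y \<le> 1")
  case True
  then have "{0..1} \<inter> {y..} = {y..1}" using assms by auto
  then have "y * measure unif01 {y..} = y * (1 - y)"
    using True by (simp add: measure_unif01)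
  also have "\<dots> \<le> 1 / 4"
    using sum_power2_ge_zero[of "y - 1 / 2" 0] by (simp add: power2_eq_square algebra_simps)
  finally show ?thesis .
next
  case False
  then have "{0..1} \<inter> {y..} = {}" by auto
  then show ?thesis by (simp add: measure_unif01)
qed

lemma expected_first_best_powr:
  fixes \<alpha> \<rho> :: real
  assumes "0 < \<alpha>" "0 < \<rho>" "\<rho> < 1"
  shows "expected_first_best (\<lambda>d. d powr \<alpha>) \<rho>
           = (1 + dstar (\<lambda>d. d powr \<alpha>) \<rho> powr (\<alpha> + 1) / \<alpha>) / 2"
  using first_best_coefficient_powr[OF assms]
  by (simp add: expected_first_best_def first_best_def integral_unif01_id)

section \<open>The value of a lending policy\<close>

text \<open>The summand of \<open>npv\<close>, named so that series and expectation can be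
  interchanged term by term.\<close>

definition loan_profit ::
  "(real \<Rightarrow> real) \<Rightarrow> real \<Rightarrow> (nat \<Rightarrow> real) \<Rightarrow> (nat \<Rightarrow> real) \<Rightarrow> nat \<Rightarrow> real \<Rightarrow> real" where
  "loan_profit s \<rho> y d t \<theta> = \<rho> ^ t * (\<Prod>i\<le>t. s (d i)) *
     (if \<forall>i<t. y i \<le> \<theta> then (if y t \<le> \<theta> then \<rho> * y t else 0) - d t * y t else 0)"

context
  fixes s :: "real \<Rightarrow> real" and \<rho> :: real and y d :: "nat \<Rightarrow> real"
  assumes \<rho>: "0 < \<rho>" "\<rho> < 1"
    and s: "\<And>x. 0 < x \<Longrightarrow> x < \<rho> \<Longrightarrow> 0 < s x \<and> s x \<le> 1"
    and policy: "lending_policy \<rho> y d"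
begin

private lemma policyD: "0 \<le> y t" "0 < d t" "d t < \<rho>"
  using policy by (auto simp: lending_policy_def)

private lemma acceptance_prob: "0 < (\<Prod>i\<le>t. s (d i))" "(\<Prod>i\<le>t. s (d i)) \<le> 1"
  using s policyD by (auto intro!: prod_pos prod_le_1 simp: less_imp_le)

lemma borel_measurable_loan_profit: "loan_profit s \<rho> y d t \<in> borel_measurable unif01"
  unfolding loan_profit_def by measurable

text \<open>
  The repayments need not be bounded, but no loan is made after one that exceeds \<open>1\<close>.
\<close>

lemma loan_profit_bounded:
  obtains B where "\<And>t \<theta>. \<theta> \<le> 1 \<Longrightarrow> \<bar>loan_profit s \<rho> y d t \<theta>\<bar> \<le> B * \<rho> ^ t"
proof -
  obtain B where B: "1 \<le> B" "\<And>t. \<forall>i<t. y i \<le> 1 \<Longrightarrow> y t \<le> B"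
  proof (cases "\<exists>t. 1 < y t")
    case True
    \<comment> \<open>The bound is the first repayment above 1: a loan after period \<open>T\<close>
      would violate the premise, and all repayments before \<open>T\<close> are at most 1.\<close>
    define T where "T = (LEAST t. 1 < y t)"
    have "1 < y T" unfolding T_def using True by (auto intro: LeastI)
    moreover have "y t \<le> y T" if "\<forall>i<t. y i \<le> 1" for t
    proof (cases "1 < y t")
      case True
      then have "T \<le> t" unfolding T_def by (rule Least_le)
      moreover have "\<not> T < t" using that \<open>1 < y T\<close> by force
      ultimately show ?thesis by simp
    qed (use \<open>1 < y T\<close> in linarith)
    ultimately show ?thesis by (intro that[of "y T"]) auto
  next
    case False
    then show ?thesis by (intro that[of 1]) (auto simp: not_less)
  qed
  have "\<bar>loan_profit s \<rho> y d t \<theta>\<bar> \<le> B * \<rho> ^ t" if "\<theta> \<le> 1" for t \<theta>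
  proof -
    let ?c = "\<rho> ^ t * (\<Prod>i\<le>t. s (d i))"
    let ?g = "if \<forall>i<t. y i \<le> \<theta> then (if y t \<le> \<theta> then \<rho> * y t else 0) - d t * y t else 0"
    have g: "\<bar>?g\<bar> \<le> B"
    proof (cases "\<forall>i<t. y i \<le> \<theta>")
      case True
      then have "y t \<le> B" using B(2)[of t] that by force
      have "\<bar>?g\<bar> \<le> 1 * y t"
      proof -
        have "0 \<le> d t * y t" "d t * y t \<le> \<rho> * y t" "\<rho> * y t \<le> 1 * y t"
          using policyD[of t] \<rho> by (auto intro!: mult_right_mono mult_left_le_one_le)
        then show ?thesis using True by auto
      qed
      with \<open>y t \<le> B\<close> show ?thesis by simp
    qed (use B in auto)
    have "0 \<le> ?c" "?c \<le> \<rho> ^ t * 1"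
      using acceptance_prob[of t] \<rho> by (auto intro!: mult_left_mono simp: less_imp_le)
    then have "\<bar>loan_profit s \<rho> y d t \<theta>\<bar> \<le> \<rho> ^ t * B"
      unfolding loan_profit_def abs_mult[of ?c] using g by (intro mult_mono) auto
    then show ?thesis by (simp add: mult.commute)
  qed
  then show ?thesis by (rule that)
qed

lemma integrable_loan_profit: "integrable unif01 (loan_profit s \<rho> y d t)"
proof -
  interpret finite_measure unif01 by (rule finite_measure_unif01)
  obtain B where B: "\<And>t \<theta>. \<theta> \<le> 1 \<Longrightarrow> \<bar>loan_profit s \<rho> y d t \<theta>\<bar> \<le> B * \<rho> ^ t"
    by (rule loan_profit_bounded) blast
  show ?thesis
    by (rule integrable_const_bound[where B = "B * \<rho> ^ t"])
      (use AE_unif01 B borel_measurable_loan_profit in \<open>auto elim: AE_mp\<close>)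
qed

text \<open>The bound B * \<rho>^t is geometric and uniform over incomes up to 1. It gives both
  summability conditions for the interchange: of the expected absolute values, and almost everywhere
  of the absolute values themselves.\<close>

lemma expected_npv_sums:
  "(\<lambda>t. \<integral>\<theta>. loan_profit s \<rho> y d t \<theta> \<partial>unif01) sums (\<integral>\<theta>. npv s \<rho> y d \<theta> \<partial>unif01)"
proof -
  interpret finite_measure unif01 by (rule finite_measure_unif01)
  obtain B where B: "\<And>t \<theta>. \<theta> \<le> 1 \<Longrightarrow> \<bar>loan_profit s \<rho> y d t \<theta>\<bar> \<le> B * \<rho> ^ t"
    by (rule loan_profit_bounded) blast
  have geometric: "summable (\<lambda>t. B * \<rho> ^ t)"
    using \<rho> by (intro summable_mult summable_geometric) auto
  have "(\<integral>\<theta>. norm (loan_profit s \<rho> y d t \<theta>) \<partial>unif01) \<le> B * \<rho> ^ t" for t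
  proof -
    have "(\<integral>\<theta>. norm (loan_profit s \<rho> y d t \<theta>) \<partial>unif01) \<le> (\<integral>\<theta>. B * \<rho> ^ t \<partial>unif01)"
      using AE_unif01 B integrable_loan_profit
      by (intro integral_mono_AE) (auto elim: AE_mp)
    then show ?thesis by (simp add: measure_unif01)
  qed
  then have "summable (\<lambda>t. \<integral>\<theta>. norm (loan_profit s \<rho> y d t \<theta>) \<partial>unif01)"
    by (intro summable_comparison_test'[OF geometric, of 0]) auto
  moreover have "AE \<theta> in unif01. summable (\<lambda>t. norm (loan_profit s \<rho> y d t \<theta>))"
    using AE_unif01
  proof eventually_elim
    case (elim \<theta>)
    then show ?case
      using B by (intro summable_comparison_test'[OF geometric, of 0]) auto
  qed
  ultimately have "(\<lambda>t. \<integral>\<theta>. loan_profit s \<rho> y d t \<theta> \<partial>unif01)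
      sums (\<integral>\<theta>. (\<Sum>t. loan_profit s \<rho> y d t \<theta>) \<partial>unif01)"
    by (intro sums_integral integrable_loan_profit)
  then show ?thesis
    by (simp add: npv_def loan_profit_def)
qed

text \<open>Forgetting the loss on a default and the exits caused by earlier repayments only raises
  the profit; what is left is the margin \<rho> - \<open>d t\<close> times the posted-price
  revenue.\<close>

lemma expected_loan_profit_le:
  "(\<integral>\<theta>. loan_profit s \<rho> y d t \<theta> \<partial>unif01) \<le> \<rho> ^ t * (\<Prod>i\<le>t. s (d i)) * (\<rho> - d t) / 4"
proof -
  define c where "c = \<rho> ^ t * (\<Prod>i\<le>t. s (d i)) * (\<rho> - d t)"
  have "0 \<le> c"
    using \<rho> acceptance_prob[of t] policyD[of t] by (auto simp: c_def)
  have "loan_profit s \<rho> y d t \<theta> \<le> c * y t * indicator {y t..} \<theta>" for \<theta>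
  proof -
    have "(if \<forall>i<t. y i \<le> \<theta> then (if y t \<le> \<theta> then \<rho> * y t else 0) - d t * y t else 0)
        \<le> (\<rho> - d t) * (y t * indicator {y t..} \<theta>)"
      using mult_right_mono[of "d t" \<rho> "y t"] policyD[of t]
      by (auto simp: indicator_def algebra_simps)
    then have "loan_profit s \<rho> y d t \<theta>
        \<le> \<rho> ^ t * (\<Prod>i\<le>t. s (d i)) * ((\<rho> - d t) * (y t * indicator {y t..} \<theta>))"
      unfolding loan_profit_def using \<rho> acceptance_prob[of t] by (intro mult_left_mono) auto
    then show ?thesis by (simp add: c_def mult.assoc)
  qed
  then have "(\<integral>\<theta>. loan_profit s \<rho> y d t \<theta> \<partial>unif01)
      \<le> (\<integral>\<theta>. c * y t * indicator {y t..} \<theta> \<partial>unif01)"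
    by (intro integral_mono integrable_loan_profit integrable_mult_right
        integrable_indicator_unif01) auto
  also have "\<dots> = c * (y t * measure unif01 {y t..})"
    by simp
  also have "\<dots> \<le> c * (1 / 4)"
    using demand_revenue_le policyD \<open>0 \<le> c\<close> by (intro mult_left_mono) auto
  finally show ?thesis by (simp add: c_def)
qed

text \<open>K * \<rho>^n * \<open>P n\<close> acts as a potential: by the hypothesis on
  \<open>K\<close>, the discounted margin of period n is at most the drop of the potential in that
  period. The potential starts at K and stays nonnegative, so all margins together are at most
  K.\<close>

lemma expected_npv_le:
  assumes K: "\<And>x. 0 < x \<Longrightarrow> x < \<rho> \<Longrightarrow> s x * (\<rho> - x) \<le> K * (1 - \<rho> * s x)" and "0 \<le> K"
  shows "(\<integral>\<theta>. npv s \<rho> y d \<theta> \<partial>unif01) \<le> K / 4"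
proof -
  \<comment> \<open>The probability that the offers before period n are all accepted. The index is
    strict, so that \<open>P 0\<close> = 1; \<open>P_Suc\<close> converts from the product up to and
    including t in \<open>npv\<close>.\<close>
  define P where "P = (\<lambda>n. \<Prod>i<n. s (d i))"
  have P: "0 \<le> P n" for n
    using s policyD by (auto simp: P_def less_imp_le intro!: prod_nonneg)
  have P_Suc: "(\<Prod>i\<le>t. s (d i)) = P t * s (d t)" for t
    by (simp add: P_def lessThan_Suc_atMost[symmetric])
  have "(\<Sum>t<n. \<rho> ^ t * (\<Prod>i\<le>t. s (d i)) * (\<rho> - d t)) \<le> K * (1 - \<rho> ^ n * P n)" for n
  proof (induction n)
    case (Suc n)
    have "\<rho> ^ n * P n * (s (d n) * (\<rho> - d n)) \<le> \<rho> ^ n * P n * (K * (1 - \<rho> * s (d n)))"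
      using K policyD P \<rho> by (intro mult_left_mono) auto
    with Suc show ?case
      unfolding P_Suc by (simp add: P_def algebra_simps)
  qed (simp add: P_def)
  moreover have "K * (1 - \<rho> ^ n * P n) \<le> K" for n
    using P \<rho> \<open>0 \<le> K\<close> by (intro mult_left_le) auto
  ultimately have partial: "(\<Sum>t<n. \<rho> ^ t * (\<Prod>i\<le>t. s (d i)) * (\<rho> - d t)) \<le> K" for n
    by (rule order_trans)
  have "(\<Sum>t<n. \<integral>\<theta>. loan_profit s \<rho> y d t \<theta> \<partial>unif01) \<le> K / 4" for n
  proof -
    have "(\<Sum>t<n. \<integral>\<theta>. loan_profit s \<rho> y d t \<theta> \<partial>unif01)
        \<le> (\<Sum>t<n. \<rho> ^ t * (\<Prod>i\<le>t. s (d i)) * (\<rho> - d t) / 4)"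
      by (intro sum_mono expected_loan_profit_le)
    also have "\<dots> \<le> K / 4"
      using partial[of n] by (simp add: sum_divide_distrib[symmetric])
    finally show ?thesis .
  qed
  then show ?thesis
    using expected_npv_sums unfolding sums_def by (intro LIMSEQ_le_const2) auto
qed

end

text \<open>
  Only the first loan of a constant repayment can default. At the rate \<open>\<rho> / 4\<close> that loan is
  profitable if half of the consumers repay it.
\<close>

lemma ex_policy_expected_npv_pos:
  fixes s :: "real \<Rightarrow> real" and \<rho> :: real
  assumes \<rho>: "0 < \<rho>" "\<rho> < 1"
    and s: "\<And>x. 0 < x \<Longrightarrow> x < \<rho> \<Longrightarrow> 0 < s x \<and> s x \<le> 1"
  shows "\<exists>y d. lending_policy \<rho> y d \<and> 0 < (\<integral>\<theta>. npv s \<rho> y d \<theta> \<partial>unif01)"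
proof -
  interpret finite_measure unif01 by (rule finite_measure_unif01)
  define y :: "nat \<Rightarrow> real" where "y = (\<lambda>_. 1 / 2)"
  define d where "d = (\<lambda>_::nat. \<rho> / 4)"
  define \<sigma> where "\<sigma> = s (\<rho> / 4)"
  have "0 < \<sigma>" using s[of "\<rho> / 4"] \<rho> by (simp add: \<sigma>_def)
  have policy: "lending_policy \<rho> y d"
    using \<rho> by (simp add: lending_policy_def y_def d_def)
  have "{0..1} \<inter> {1 / 2..} = {1 / 2..1::real}" by auto
  then have half: "measure unif01 {1 / 2..} = 1 / 2"
    by (simp add: measure_unif01)
  \<comment> \<open>Everyone who accepts receives \<rho>/8, and the half with \<theta> \<ge> 1/2
    returns 1/2, worth \<rho>/2 in present value.\<close>
  have "loan_profit s \<rho> y d 0 = (\<lambda>\<theta>. \<sigma> * \<rho> / 2 * indicator {1 / 2..} \<theta> - \<sigma> * \<rho> / 8)"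
    by (auto simp: loan_profit_def y_def d_def \<sigma>_def indicator_def algebra_simps)
  then have "(\<integral>\<theta>. loan_profit s \<rho> y d 0 \<theta> \<partial>unif01) = \<sigma> * \<rho> / 8"
    using half integrable_indicator_unif01[of "{1 / 2..}"] by (simp add: measure_unif01)
  \<comment> \<open>A later loan goes only to incomes that repaid 1/2 in period 0; they repay again,
    at a positive margin.\<close>
  moreover have "0 \<le> (\<integral>\<theta>. loan_profit s \<rho> y d (Suc t) \<theta> \<partial>unif01)" for t
    using \<rho> \<open>0 < \<sigma>\<close>
    by (intro Bochner_Integration.integral_nonneg) (auto simp: loan_profit_def y_def d_def \<sigma>_def less_imp_le)
  then have "0 \<le> (\<integral>\<theta>. loan_profit s \<rho> y d t \<theta> \<partial>unif01)" if "t \<noteq> 0" for t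
    using that by (cases t) auto
  moreover have sums: "(\<lambda>t. \<integral>\<theta>. loan_profit s \<rho> y d t \<theta> \<partial>unif01)
      sums (\<integral>\<theta>. npv s \<rho> y d \<theta> \<partial>unif01)"
    using s by (intro expected_npv_sums \<rho> policy)
  ultimately have "\<sigma> * \<rho> / 8 \<le> (\<integral>\<theta>. npv s \<rho> y d \<theta> \<partial>unif01)"
    using sum_le_suminf[OF sums_summable[OF sums], where I = "{0}"] sums_unique[OF sums] by simp
  then show ?thesis
    using policy mult_pos_pos[OF \<open>0 < \<sigma>\<close> \<rho>(1)] by fastforce
qed

text \<open>A real \<open>Sup\<close> is informative only for a nonempty set that is bounded above:
  the explicit policy supplies a positive member, the telescoping bound an upper bound. Positivity
  matters because the regret divides by this value.\<close>

lemma optimal_npv_bounds: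
  fixes s :: "real \<Rightarrow> real" and \<rho> K :: real
  assumes \<rho>: "0 < \<rho>" "\<rho> < 1"
    and s: "\<And>x. 0 < x \<Longrightarrow> x < \<rho> \<Longrightarrow> 0 < s x \<and> s x \<le> 1"
    and K: "\<And>x. 0 < x \<Longrightarrow> x < \<rho> \<Longrightarrow> s x * (\<rho> - x) \<le> K * (1 - \<rho> * s x)" "0 \<le> K"
  shows "0 < optimal_npv s \<rho>" "optimal_npv s \<rho> \<le> K / 4"
proof -
  let ?V = "{(\<integral>\<theta>. npv s \<rho> y d \<theta> \<partial>unif01) | y d. lending_policy \<rho> y d}"
  have "(\<integral>\<theta>. npv s \<rho> y d \<theta> \<partial>unif01) \<le> K / 4" if "lending_policy \<rho> y d" for y d
    using s K by (intro expected_npv_le[where s = s] \<rho> that)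
  then have ub: "v \<le> K / 4" if "v \<in> ?V" for v
    using that by blast
  have "\<exists>y d. lending_policy \<rho> y d \<and> 0 < (\<integral>\<theta>. npv s \<rho> y d \<theta> \<partial>unif01)"
    using s by (intro ex_policy_expected_npv_pos \<rho>)
  then obtain v where v: "v \<in> ?V" "0 < v"
    by blast
  show "optimal_npv s \<rho> \<le> K / 4"
    unfolding optimal_npv_def using v(1) ub by (intro cSup_least) blast+
  have "v \<le> optimal_npv s \<rho>"
    unfolding optimal_npv_def using v(1) ub by (intro cSup_upper bdd_aboveI)
  with v show "0 < optimal_npv s \<rho>" by simp
qed

text \<open>Read off from the formula, without viewing it as the value of a policy: the factor in
  front of K is (1 - x)^(\<alpha> + 1) * x, and an exponent above 1 on a base below 1 leaves at most
  (1 - x) * x \<le> 1/4.\<close>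

lemma closed_form_npv_bounds:
  fixes \<alpha> \<rho> :: real
  assumes "0 < \<alpha>" "0 < \<rho>" "\<rho> < 1"
  shows "0 < closed_form_npv \<alpha> \<rho>"
    "closed_form_npv \<alpha> \<rho> \<le> dstar (\<lambda>d. d powr \<alpha>) \<rho> powr (\<alpha> + 1) / \<alpha> / 4"
proof -
  define x where "x = 1 / (\<alpha> + 2)"
  define D where "D = dstar (\<lambda>d. d powr \<alpha>) \<rho> powr (\<alpha> + 1)"
  have x: "0 < x" "x < 1" using assms by (auto simp: x_def)
  have "0 < D" using dstar_powr[OF assms] by (simp add: D_def)
  have eq: "closed_form_npv \<alpha> \<rho> = ((1 - x) powr (\<alpha> + 1) * x) * (D / \<alpha>)"
    using x dstar_powr(1)[OF assms]
    by (simp add: closed_form_npv_def Let_def x_def[symmetric] D_def powr_mult)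
  show "0 < closed_form_npv \<alpha> \<rho>"
    using x \<open>0 < D\<close> assms by (simp add: eq)
  have "(1 - x) powr (\<alpha> + 1) \<le> (1 - x) powr 1"
    using x assms by (intro powr_mono') auto
  then have "(1 - x) powr (\<alpha> + 1) * x \<le> (1 - x) * x"
    using x by (intro mult_right_mono) auto
  also have "\<dots> \<le> 1 / 4"
    using sum_power2_ge_zero[of "x - 1 / 2" 0] by (simp add: power2_eq_square algebra_simps)
  finally have "closed_form_npv \<alpha> \<rho> \<le> 1 / 4 * (D / \<alpha>)"
    unfolding eq using \<open>0 < D\<close> assms by (intro mult_right_mono) auto
  then show "closed_form_npv \<alpha> \<rho> \<le> dstar (\<lambda>d. d powr \<alpha>) \<rho> powr (\<alpha> + 1) / \<alpha> / 4"
    by (simp add: D_def)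
qed

section \<open>Relative regret\<close>

text \<open>Stated for any positive \<open>v\<close> up to K/4, so that it serves both the closed
  form and the optimum. As \<delta> < \<rho> < 1, K is at most \<rho> / \<alpha>, which turns 2 / K
  into a bound explicit in \<rho> that blows up as \<rho> tends to 0.\<close>

lemma relative_regret_powr_ge:
  fixes \<alpha> \<rho> v :: real
  assumes "0 < \<alpha>" "0 < \<rho>" "\<rho> < 1"
    and v: "0 < v" "v \<le> dstar (\<lambda>d. d powr \<alpha>) \<rho> powr (\<alpha> + 1) / \<alpha> / 4"
  shows "2 + 2 * \<alpha> / \<rho> \<le> relative_regret (expected_first_best (\<lambda>d. d powr \<alpha>) \<rho>) v"
proof -
  define \<delta> where "\<delta> = dstar (\<lambda>d. d powr \<alpha>) \<rho>"
  define K where "K = \<delta> powr (\<alpha> + 1) / \<alpha>"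
  have \<delta>: "0 < \<delta>" "\<delta> < \<rho>"
    using dstar_powr assms by (auto simp: \<delta>_def)
  then have "0 < K" using assms by (simp add: K_def)
  have "\<delta> powr (\<alpha> + 1) \<le> \<delta> powr 1"
    using \<delta> assms by (intro powr_mono') auto
  then have "K \<le> \<rho> / \<alpha>"
    using \<delta> assms by (simp add: K_def divide_right_mono)
  then have "2 + 2 * \<alpha> / \<rho> \<le> 2 + 2 / K"
    using \<open>0 < K\<close> assms by (simp add: field_simps)
  also have "\<dots> = ((1 + K) / 2) / (K / 4)"
    using \<open>0 < K\<close> by (simp add: field_simps)
  also have "\<dots> \<le> ((1 + K) / 2) / v"
    using \<open>0 < K\<close> v by (intro frac_le) (auto simp: K_def \<delta>_def)
  finally show ?thesis
    using assms by (simp add: relative_regret_def expected_first_best_powr K_def \<delta>_def)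
qed

theorem proposition5p3:
  fixes \<alpha> :: real and s :: "real \<Rightarrow> real" and R_closed R_opt :: "real \<Rightarrow> real"
  assumes alpha: "0 < \<alpha>" "\<alpha> < 1"
  defines "s \<equiv> \<lambda>d. d powr \<alpha>"
  defines "R_closed \<equiv> \<lambda>\<rho>. relative_regret (expected_first_best s \<rho>) (closed_form_npv \<alpha> \<rho>)"
  defines "R_opt \<equiv> \<lambda>\<rho>. relative_regret (expected_first_best s \<rho>) (optimal_npv s \<rho>)"
  shows "((\<forall>\<rho>\<in>{0<..<1}. R_closed \<rho> \<ge> 2) \<and> (\<forall>M>0. \<exists>\<rho>\<in>{0<..<1}. R_closed \<rho> > M)) \<and>
         ((\<forall>\<rho>\<in>{0<..<1}. R_opt \<rho> \<ge> 2) \<and> (\<forall>M>0. \<exists>\<rho>\<in>{0<..<1}. R_opt \<rho> > M))"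
proof -
  have closed: "2 + 2 * \<alpha> / \<rho> \<le> R_closed \<rho>" if "0 < \<rho>" "\<rho> < 1" for \<rho>
    unfolding R_closed_def s_def
    using alpha(1) that by (intro relative_regret_powr_ge closed_form_npv_bounds)
  have opt: "2 + 2 * \<alpha> / \<rho> \<le> R_opt \<rho>" if \<rho>: "0 < \<rho>" "\<rho> < 1" for \<rho>
  proof -
    have "0 < x powr \<alpha> \<and> x powr \<alpha> \<le> 1" if "0 < x" "x < \<rho>" for x
      using that \<rho> alpha powr_mono2[of \<alpha> x 1] by auto
    note bounds = optimal_npv_bounds[OF \<rho> this powr_rate_value_le[OF alpha(1) \<rho>]]
    show ?thesis
      unfolding R_opt_def s_def
      using alpha(1) \<rho> by (intro relative_regret_powr_ge bounds) auto
  qed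
  have large: "\<exists>\<rho>\<in>{0<..<1}. M < 2 + 2 * \<alpha> / \<rho>" if "0 < M" for M
  proof -
    \<comment> \<open>The second entry makes 2 * \<alpha> / \<rho> at least M, the first keeps
      \<rho> below 1; the summand 2 makes the inequality strict.\<close>
    define \<rho> where "\<rho> = min (1 / 2) (2 * \<alpha> / M)"
    have "0 < \<rho>" "\<rho> < 1" "\<rho> \<le> 2 * \<alpha> / M"
      using that alpha by (auto simp: \<rho>_def)
    moreover from this have "M \<le> 2 * \<alpha> / \<rho>"
      using that by (simp add: field_simps)
    ultimately show ?thesis by (intro bexI[of _ \<rho>]) auto
  qed
  have "2 \<le> 2 + 2 * \<alpha> / \<rho>" if "0 < \<rho>" for \<rho>
    using that alpha by simp
  then show ?thesis
    using closed opt large by (meson greaterThanLessThan_iff less_le_trans order_trans)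
qed

end
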